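(* Let $d \in [0, 1/6)$. Let (P3) be the problem of maximizing $$\widehat{W}_3 = e_0 r_0\left(\frac{1}{q_0}\Big(\frac1e-\frac1{e_0}\Big) + r\left(\frac1p\Big(\frac1q\Big(\frac1e-\frac1f\Big)+\frac1{q_0}\Big(\frac1e-\frac1{e_0}\Big)\Big)\right)\right)$$ over real variables $e_0,e,f,q_0,q,p,r_0,r$ subject to $e_0,e,f\in[1-d,1]$, $q_0\in[e_0+e-1-d,\,e_0]$, $q\in[e+f-1-d,\,e]$, $p\in[q_0+q-e-d,\,q_0]$, $r_0\in[1/2,\,e_0]$, $r\in[0,q_0]$. Let (P4) be the problem of maximizing $$\widehat{W}_4(e_0,f)=e_0^2\left(\frac{\frac1{1-d}-\frac1{e_0}}{e_0-2d}+\frac{e_0-2d}{e_0+f-1-4d}\left(\frac{\frac1{1-d}-\frac1f}{f-2d}+\frac{\frac1{1-d}-\frac1{e_0}}{e_0-2d}\right)\right)$$ subject to $e_0\in[1-d,1]$, $f\in[1-d,1]$. Then the optimal values of (P3) and (P4) are equal. *)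

theory Defs
  imports Complex_Main "HOL-Library.Extended_Real"
begin

text \<open>The optimal value of a maximization problem is the supremum of the objective over the
  feasible set. It is taken in the extended reals, since \<^const>\<open>Sup\<close> on the reals is
  unspecified for empty or unbounded sets.\<close>

definition optimal_value :: "('a \<Rightarrow> real) \<Rightarrow> 'a set \<Rightarrow> ereal" where
  "optimal_value W S = (SUP x\<in>S. ereal (W x))"

type_synonym P3_vars = "real \<times> real \<times> real \<times> real \<times> real \<times> real \<times> real \<times> real"

definition P3_feasible :: "real \<Rightarrow> P3_vars set" where
  "P3_feasible d = {(e0, e, f, q0, q, p, r0, r).
     e0 \<in> {1 - d..1} \<and> e \<in> {1 - d..1} \<and> f \<in> {1 - d..1} \<and>
     q0 \<in> {e0 + e - 1 - d..e0} \<and>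
     q \<in> {e + f - 1 - d..e} \<and>
     p \<in> {q0 + q - e - d..q0} \<and>
     r0 \<in> {1/2..e0} \<and>
     r \<in> {0..q0}}"

definition W3_hat :: "P3_vars \<Rightarrow> real" where
  "W3_hat = (\<lambda>(e0, e, f, q0, q, p, r0, r).
     e0 * r0 * (1/q0 * (1/e - 1/e0)
       + r * (1/p * (1/q * (1/e - 1/f) + 1/q0 * (1/e - 1/e0)))))"

definition P4_feasible :: "real \<Rightarrow> (real \<times> real) set" where
  "P4_feasible d = {(e0, f). e0 \<in> {1 - d..1} \<and> f \<in> {1 - d..1}}"

definition W4_hat :: "real \<Rightarrow> real \<times> real \<Rightarrow> real" where
  "W4_hat d = (\<lambda>(e0, f).
     e0\<^sup>2 * ((1/(1 - d) - 1/e0) / (e0 - 2*d)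
       + (e0 - 2*d) / (e0 + f - 1 - 4*d)
         * ((1/(1 - d) - 1/f) / (f - 2*d) + (1/(1 - d) - 1/e0) / (e0 - 2*d))))"

end

theory Submission
  imports Defs
begin

text \<open>Both problems dominate each other pointwise. Fixing \<open>e = 1 - d\<close> and \<open>r\<^sub>0 = e\<^sub>0\<close>, taking
  \<open>q\<^sub>0\<close>, \<open>q\<close>, \<open>p\<close> minimal and \<open>r = q\<^sub>0\<close> maximal turns the objective of (P3) into that of (P4).
  Conversely, this choice maximizes every factor of the objective of (P3) separately for given
  \<open>e\<^sub>0\<close> and \<open>f\<close>: the differences \<open>1/e - 1/e\<^sub>0\<close> and \<open>1/e - 1/f\<close> become nonnegative and maximal, and
  \<open>r/p\<close> is at most \<open>q\<^sub>0/(q\<^sub>0 - s)\<close> with \<open>s = 1 + 2d - f \<ge> 0\<close>, which decreases in \<open>q\<^sub>0\<close>.\<close>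

lemma P4_embeds_in_P3:
  fixes d :: real
  assumes "0 \<le> d" "d < 1/6" "(e0, f) \<in> P4_feasible d"
  defines "x \<equiv> (e0, 1 - d, f, e0 - 2*d, f - 2*d, e0 + f - 1 - 4*d, e0, e0 - 2*d)"
  shows "x \<in> P3_feasible d" and "W3_hat x = W4_hat d (e0, f)"
  using assms by (auto simp: P3_feasible_def P4_feasible_def W3_hat_def W4_hat_def power2_eq_square)

text \<open>The sign condition is on \<open>b\<close> because \<open>a\<close> will be
  \<open>1/e - 1/e0\<close> or \<open>1/e - 1/f\<close>, which can be negative.\<close>

lemma divide_le_divide_of_nonneg:
  fixes a b c e :: real
  assumes "a \<le> b" "0 \<le> b" "0 < c" "c \<le> e"
  shows "a / e \<le> b / c"
proof -
  have "a / e \<le> b / e" using assms by (intro divide_right_mono) auto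
  also have "\<dots> \<le> b / c" using assms by (intro divide_left_mono) auto
  finally show ?thesis .
qed

lemma W3_hat_le_W4_hat:
  fixes d :: real
  assumes "0 \<le> d" "d < 1/6" and feas: "(e0, e, f, q0, q, p, r0, r) \<in> P3_feasible d"
  shows "W3_hat (e0, e, f, q0, q, p, r0, r) \<le> W4_hat d (e0, f)"
proof -
  have b: "1 - d \<le> e0" "e0 \<le> 1" "1 - d \<le> e" "e \<le> 1" "1 - d \<le> f" "f \<le> 1"
    "e0 + e - 1 - d \<le> q0" "e + f - 1 - d \<le> q" "q0 + q - e - d \<le> p"
    "1/2 \<le> r0" "r0 \<le> e0" "0 \<le> r" "r \<le> q0"
    using feas by (auto simp: P3_feasible_def)
  define A where "A = (1/(1 - d) - 1/e0) / (e0 - 2*d)"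
  define B where "B = (1/(1 - d) - 1/f) / (f - 2*d)"
  define C where "C = (e0 - 2*d) / (e0 + f - 1 - 4*d)"
  have diff_le: "1/e - 1/x \<le> 1/(1 - d) - 1/x" for x
    using b assms by (simp add: frac_le)
  have diff_nonneg: "0 \<le> 1/(1 - d) - 1/x" if "1 - d \<le> x" for x
    using that assms by (simp add: frac_le)
  have A: "1/q0 * (1/e - 1/e0) \<le> A"
    using divide_le_divide_of_nonneg[OF diff_le diff_nonneg, of e0 "e0 - 2*d" q0] b assms
    by (simp add: A_def)
  have B: "1/q * (1/e - 1/f) \<le> B"
    using divide_le_divide_of_nonneg[OF diff_le diff_nonneg, of f "f - 2*d" q] b assms
    by (simp add: B_def)
  have nonneg: "0 \<le> A" "0 \<le> B" "0 \<le> C"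
    using b assms diff_nonneg by (simp_all add: A_def B_def C_def)
  \<comment> \<open>Inserting the lower bound on \<open>q\<close> into that on \<open>p\<close>
    cancels \<open>e\<close> and leaves \<open>q0 - s \<le> p\<close>. Moreover
    \<open>e0 - 2*d - s = e0 + f - 1 - 4*d\<close> is at least \<open>1 - 6*d\<close>, which is
    positive as \<open>d < 1/6\<close>.\<close>
  define s where "s = 1 + 2*d - f"
  have s: "0 \<le> s" "q0 - s \<le> p" "0 < e0 - 2*d - s" "e0 - 2*d \<le> q0"
    using b assms by (auto simp: s_def)
  have "r / p \<le> q0 / (q0 - s)"
    using b s assms by (intro frac_le) auto
  \<comment> \<open>Now \<open>q0\<close> occurs only in a denominator, so its lower bound
    applies.\<close>
  also have "\<dots> = 1 + s / (q0 - s)"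
    using s by (simp add: field_simps)
  also have "\<dots> \<le> 1 + s / (e0 - 2*d - s)"
    using s by (intro add_left_mono divide_le_divide_of_nonneg) auto
  also have "\<dots> = (e0 - 2*d) / (e0 - 2*d - s)"
    using s by (simp add: field_simps)
  also have "\<dots> = C"
    by (simp add: C_def s_def algebra_simps)
  finally have C: "r / p \<le> C" .
  \<comment> \<open>The bracket may be negative, so it is first raised to
    \<open>B + A \<ge> 0\<close>; only then can \<open>r / p\<close> be raised to
    \<open>C\<close>.\<close>
  have "0 \<le> r / p"
    using b s by simp
  then have "r / p * (1/q * (1/e - 1/f) + 1/q0 * (1/e - 1/e0)) \<le> r / p * (B + A)"
    using A B by (intro mult_left_mono) auto
  also have "\<dots> \<le> C * (B + A)"
    using C nonneg by (intro mult_right_mono) auto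
  finally have "1/q0 * (1/e - 1/e0) + r * (1/p * (1/q * (1/e - 1/f) + 1/q0 * (1/e - 1/e0)))
      \<le> A + C * (B + A)"
    using A by simp
  then have "W3_hat (e0, e, f, q0, q, p, r0, r) \<le> e0 * r0 * (A + C * (B + A))"
    unfolding W3_hat_def prod.case using b assms by (intro mult_left_mono) auto
  also have "\<dots> \<le> e0\<^sup>2 * (A + C * (B + A))"
    unfolding power2_eq_square using b assms nonneg
    by (intro mult_right_mono mult_left_mono) auto
  also have "\<dots> = W4_hat d (e0, f)"
    by (simp add: W4_hat_def A_def B_def C_def)
  finally show ?thesis .
qed

theorem theorem4p8:
  fixes d :: real
  assumes "d \<in> {0..<1/6}"
  shows "optimal_value W3_hat (P3_feasible d) = optimal_value (W4_hat d) (P4_feasible d)"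
proof (rule antisym)
  have d: "0 \<le> d" "d < 1/6" using assms by auto
  show "optimal_value W3_hat (P3_feasible d) \<le> optimal_value (W4_hat d) (P4_feasible d)"
    unfolding optimal_value_def
  proof (rule SUP_mono)
    fix x assume x: "x \<in> P3_feasible d"
    obtain e0 e f q0 q p r0 r where [simp]: "x = (e0, e, f, q0, q, p, r0, r)"
      by (metis prod.exhaust)
    have "(e0, f) \<in> P4_feasible d"
      using x by (auto simp: P3_feasible_def P4_feasible_def)
    moreover have "ereal (W3_hat x) \<le> ereal (W4_hat d (e0, f))"
      using W3_hat_le_W4_hat[OF d] x by simp
    ultimately show "\<exists>y\<in>P4_feasible d. ereal (W3_hat x) \<le> ereal (W4_hat d y)" by blast
  qed
  show "optimal_value (W4_hat d) (P4_feasible d) \<le> optimal_value W3_hat (P3_feasible d)"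
    unfolding optimal_value_def
  proof (rule SUP_mono)
    fix y assume y: "y \<in> P4_feasible d"
    obtain e0 f where "y = (e0, f)" by (cases y)
    then show "\<exists>x\<in>P3_feasible d. ereal (W4_hat d y) \<le> ereal (W3_hat x)"
      using P4_embeds_in_P3[OF d, of e0 f] y by (metis order_refl)
  qed
qed

end
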